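(* Let $\mathbf{p}=\{p_1,\dots,p_n\}$ and $\mathbf{r}=\{r_1,\dots,r_n\}$ be two probability distributions with $p_j>0$ and $r_j>0$ for all $j=1,\dots,n$, and let $0\le q<1$. Let $r$ denote the scalar $r=\min\{q,1-q\}$, and put $A(q)=\frac{q(1-q)}{2}-\frac{r}{4}$, $B(q)=\frac{q(1-q)}{2}-\frac{1-r}{4}$. Then $$\frac{4r}{1-q}h^2(\mathbf{p}|\mathbf{r})+\frac{2A(q)}{1-q}\sum_{j=1}^np_jr_j\log^2\left(\frac{p_j}{r_j}\right)\le J_q(\mathbf{p}|\mathbf{r})\le\frac{4(1-r)}{1-q}h^2(\mathbf{p}|\mathbf{r})+\frac{2B(q)}{1-q}\sum_{j=1}^np_jr_j\log^2\left(\frac{p_j}{r_j}\right).$$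
   Context: A probability distribution satisfies $\sum_j p_j=1$. For probability distributions $\mathbf{p},\mathbf{r}$ with positive entries and $q\ge0$, $q\ne1$, the Tsallis divergence is $D_q^T(\mathbf{p}|\mathbf{r}):=\sum_{j=1}^n\frac{p_j-p_j^qr_j^{1-q}}{1-q}$, and the Jeffreys-Tsallis divergence is $J_q(\mathbf{p}|\mathbf{r}):=D_q^T(\mathbf{p}|\mathbf{r})+D_q^T(\mathbf{r}|\mathbf{p})$. The Hellinger distance is $h(\mathbf{p}|\mathbf{r}):=\frac{1}{\sqrt2}\sqrt{\sum_{j=1}^n(\sqrt{p_j}-\sqrt{r_j})^2}$, and $h^2$ denotes its square. Here $\log$ is the natural logarithm and $\log^2(x)=(\log x)^2$. *)

theory Defs
  imports Complex_Main
begin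

text \<open>Distributions are indexed by \<open>1, \<dots>, n\<close>; the values of the functions outside this range
  are irrelevant.\<close>

definition prob_distribution :: "nat \<Rightarrow> (nat \<Rightarrow> real) \<Rightarrow> bool" where
  "prob_distribution n p \<longleftrightarrow> (\<forall>j\<in>{1..n}. 0 \<le> p j) \<and> (\<Sum>j=1..n. p j) = 1"

text \<open>The divergence is meant for positive entries and \<open>0 \<le> q\<close>, \<open>q \<noteq> 1\<close>. For positive \<open>x\<close>, \<open>x powr a\<close>
  is the usual real power, and in particular \<open>x powr 0 = 1\<close>.\<close>

definition tsallis_divergence :: "nat \<Rightarrow> real \<Rightarrow> (nat \<Rightarrow> real) \<Rightarrow> (nat \<Rightarrow> real) \<Rightarrow> real" where
  "tsallis_divergence n q p r =
     (\<Sum>j=1..n. (p j - p j powr q * r j powr (1 - q)) / (1 - q))"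

definition jeffreys_tsallis_divergence :: "nat \<Rightarrow> real \<Rightarrow> (nat \<Rightarrow> real) \<Rightarrow> (nat \<Rightarrow> real) \<Rightarrow> real" where
  "jeffreys_tsallis_divergence n q p r = tsallis_divergence n q p r + tsallis_divergence n q r p"

definition hellinger_distance :: "nat \<Rightarrow> (nat \<Rightarrow> real) \<Rightarrow> (nat \<Rightarrow> real) \<Rightarrow> real" where
  "hellinger_distance n p r = 1 / sqrt 2 * sqrt (\<Sum>j=1..n. (sqrt (p j) - sqrt (r j))\<^sup>2)"

definition weight :: "real \<Rightarrow> real" where
  "weight q = min q (1 - q)"

definition A_coeff :: "real \<Rightarrow> real" where
  "A_coeff q = q * (1 - q) / 2 - weight q / 4"

definition B_coeff :: "real \<Rightarrow> real" where
  "B_coeff q = q * (1 - q) / 2 - (1 - weight q) / 4"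

end

theory Submission
  imports Defs "HOL-Analysis.Convex"
begin

text \<open>
  The inequality already holds for each index separately. Write \<open>p\<^sub>j = s exp y\<close> and
  \<open>r\<^sub>j = s exp (- y)\<close>, so that \<open>s\<close> is the geometric mean of the two entries and
  \<open>ln (p\<^sub>j / r\<^sub>j) = 2 y\<close>, and put \<open>u = \<bar>2 q - 1\<bar>\<close>. Every term becomes a hyperbolic cosine:
  \<open>p\<^sub>j + r\<^sub>j = 2 s cosh y\<close>, the mixed powers of the Jeffreys-Tsallis divergence add up to
  \<open>2 s cosh (u y)\<close>, and \<open>(sqrt p\<^sub>j - sqrt r\<^sub>j)\<^sup>2 = 2 s (cosh y - 1)\<close>. The coefficients become
  \<open>min q (1 - q) = (1 - u) / 2\<close>, \<open>A = u (1 - u) / 8\<close> and \<open>B = - u (1 + u) / 8\<close>.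

  In terms of the remainder \<open>g z = cosh z - 1 - z\<^sup>2 / 2\<close>, the lower bound follows from
  \<open>g (u y) \<le> u g y\<close> and the upper bound from \<open>0 \<le> u g y + g (u y)\<close>. Both hold because \<open>g\<close> is
  convex and even with \<open>g 0 = 0\<close> (lemmas \<open>cosh_remainder_scale\<close> and \<open>cosh_remainder_nonneg\<close>).

  This yields the estimates with \<open>s y\<^sup>2\<close> as the logarithmic term, whereas the claim has
  \<open>s\<^sup>2 y\<^sup>2\<close>. The entries of a probability distribution are at most \<open>1\<close>, hence \<open>s \<le> 1\<close>; since
  \<open>A \<ge> 0 \<ge> B\<close>, passing from \<open>s\<close> to \<open>s\<^sup>2\<close> weakens both bounds.
\<close>

definition cosh_remainder :: "real \<Rightarrow> real" where
  "cosh_remainder z = cosh z - 1 - z\<^sup>2 / 2"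

lemma convex_cosh_remainder: "convex_on UNIV cosh_remainder"
  unfolding cosh_remainder_def
  by (rule f''_ge0_imp_convex[where f' = "\<lambda>z. sinh z - z" and f'' = "\<lambda>z. cosh z - 1"])
     (auto intro!: derivative_eq_intros simp: cosh_real_ge_1)

text \<open>A convex function that vanishes at \<open>0\<close> lies below its chord from \<open>0\<close>.\<close>

lemma cosh_remainder_scale:
  assumes "0 \<le> u" and "u \<le> 1"
  shows "cosh_remainder (u * y) \<le> u * cosh_remainder y"
  using convex_onD[OF convex_cosh_remainder assms, of 0 y]
  by (simp add: cosh_remainder_def)

text \<open>\<open>0\<close> is the midpoint of \<open>z\<close> and \<open>- z\<close>, where an even function takes the same value.\<close>

lemma cosh_remainder_nonneg: "0 \<le> cosh_remainder z"
  using convex_onD[OF convex_cosh_remainder, of "1/2" z "- z"]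
  by (simp add: cosh_remainder_def)

lemma weight_eq: "weight q = (1 - \<bar>2 * q - 1\<bar>) / 2"
  by (auto simp: weight_def min_def abs_if field_simps)

lemma A_coeff_eq: "A_coeff q = \<bar>2 * q - 1\<bar> * (1 - \<bar>2 * q - 1\<bar>) / 8"
  by (auto simp: A_coeff_def weight_eq abs_if field_simps power2_eq_square)

lemma B_coeff_eq: "B_coeff q = - (\<bar>2 * q - 1\<bar> * (1 + \<bar>2 * q - 1\<bar>) / 8)"
  by (auto simp: B_coeff_def weight_eq abs_if field_simps power2_eq_square)

text \<open>After the substitution both bounds share the factor \<open>s\<close>; cancelling it leaves the facts
  \<open>lower\<close> and \<open>upper\<close>. With \<open>1\<close> in place of their leading \<open>s\<close>, these are the two properties
  of the remainder multiplied by \<open>2\<close>.\<close>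

lemma jeffreys_pointwise_bounds:
  fixes a b q :: real
  assumes "0 < a" and "0 < b" and "a \<le> 1" and "b \<le> 1" and "0 \<le> q" and "q \<le> 1"
  defines "J \<equiv> a + b - a powr q * b powr (1 - q) - b powr q * a powr (1 - q)"
  shows "2 * weight q * (sqrt a - sqrt b)\<^sup>2 + 2 * A_coeff q * (a * b * (ln (a / b))\<^sup>2) \<le> J"
    and "J \<le> 2 * (1 - weight q) * (sqrt a - sqrt b)\<^sup>2 + 2 * B_coeff q * (a * b * (ln (a / b))\<^sup>2)"
proof -
  define s where "s = sqrt (a * b)"
  define y where "y = ln (a / b) / 2"
  define u where "u = \<bar>2 * q - 1\<bar>"
  have s: "0 < s" "s \<le> 1" "s\<^sup>2 = a * b"
    using assms by (auto simp: s_def mult_le_one)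
  have u: "0 \<le> u" "u \<le> 1"
    using assms by (auto simp: u_def)
  have s_exp: "s = exp ((ln a + ln b) / 2)"
  proof -
    have "ln s = (ln a + ln b) / 2"
      using assms by (simp add: s_def ln_mult ln_sqrt)
    then show ?thesis using s(1) by (metis exp_ln)
  qed
  have y_eq: "y = (ln a - ln b) / 2"
    using assms by (simp add: y_def ln_div)
  have ab: "a + b = s * (2 * cosh y)"
  proof -
    have "a = s * exp y" "b = s * exp (- y)"
      using assms by (simp_all add: s_exp y_eq flip: exp_add) (simp_all add: field_simps)
    then show ?thesis by (simp add: cosh_field_def algebra_simps)
  qed
  have mixed: "a powr q * b powr (1 - q) + b powr q * a powr (1 - q) = s * (2 * cosh (u * y))"
  proof -
    have "a powr q * b powr (1 - q) = s * exp ((2 * q - 1) * y)"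
      and "b powr q * a powr (1 - q) = s * exp (- ((2 * q - 1) * y))"
      using assms by (simp_all add: powr_def s_exp y_eq field_simps flip: exp_add)
    moreover have "cosh (u * y) = cosh ((2 * q - 1) * y)"
    proof (cases "2 * q < 1")
      case True
      then have "u * y = - ((2 * q - 1) * y)" by (simp add: u_def algebra_simps)
      then show ?thesis by (simp only: cosh_minus)
    qed (simp add: u_def)
    ultimately show ?thesis by (simp add: cosh_field_def algebra_simps)
  qed
  have hell: "(sqrt a - sqrt b)\<^sup>2 = s * (2 * cosh y - 2)"
    using assms ab by (simp add: power2_diff s_def real_sqrt_mult algebra_simps)
  have J: "J = s * (2 * cosh y - 2 * cosh (u * y))"
    using ab mixed by (simp add: J_def algebra_simps)
  have log_term: "a * b * (ln (a / b))\<^sup>2 = s * (s * (4 * y\<^sup>2))"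
    unfolding s(3)[symmetric] by (simp add: y_def power2_eq_square)
  \<comment> \<open>The only place where \<open>s \<le> 1\<close> enters: each logarithmic term carries one factor \<open>s\<close> more
    than its hyperbolic counterpart.\<close>
  have s_le: "s * (c * y\<^sup>2) \<le> c * y\<^sup>2" if "0 \<le> c" for c
    using that s by (intro mult_left_le_one_le) auto
  have lower: "s * (u * (1 - u) * y\<^sup>2) \<le> 2 * u * cosh y + 2 * (1 - u) - 2 * cosh (u * y)"
    using cosh_remainder_scale[OF u, of y] s_le[OF mult_nonneg_nonneg, of u "1 - u"] u
    by (simp add: cosh_remainder_def algebra_simps power2_eq_square)
  have upper: "s * (u * (1 + u) * y\<^sup>2) \<le> 2 * u * cosh y + 2 * cosh (u * y) - 2 * (1 + u)"
    using mult_left_mono[OF cosh_remainder_nonneg[of y] u(1)] cosh_remainder_nonneg[of "u * y"]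
      s_le[of "u * (1 + u)"] u
    by (simp add: cosh_remainder_def algebra_simps power2_eq_square)
  show "2 * weight q * (sqrt a - sqrt b)\<^sup>2 + 2 * A_coeff q * (a * b * (ln (a / b))\<^sup>2) \<le> J"
    unfolding weight_eq A_coeff_eq hell J log_term u_def[symmetric]
    using mult_left_mono[OF lower, of s] s by (simp add: field_simps)
  show "J \<le> 2 * (1 - weight q) * (sqrt a - sqrt b)\<^sup>2 + 2 * B_coeff q * (a * b * (ln (a / b))\<^sup>2)"
    unfolding weight_eq B_coeff_eq hell J log_term u_def[symmetric]
    using mult_left_mono[OF upper, of s] s by (simp add: field_simps)
qed

lemma prob_distribution_le_1:
  assumes "prob_distribution n p" and "j \<in> {1..n}"
  shows "p j \<le> 1"
  using assms member_le_sum[of j "{1..n}" p] by (auto simp: prob_distribution_def)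

lemma hellinger_distance_squared:
  "(hellinger_distance n p r)\<^sup>2 = (\<Sum>j=1..n. (sqrt (p j) - sqrt (r j))\<^sup>2) / 2"
  by (simp add: hellinger_distance_def power_mult_distrib power_divide sum_nonneg)

theorem theorem3p5:
  fixes n :: nat and p r :: "nat \<Rightarrow> real" and q :: real
  assumes "prob_distribution n p" and "prob_distribution n r"
    and "\<And>j. j \<in> {1..n} \<Longrightarrow> 0 < p j" and "\<And>j. j \<in> {1..n} \<Longrightarrow> 0 < r j"
    and "0 \<le> q" and "q < 1"
  shows "4 * weight q / (1 - q) * (hellinger_distance n p r)\<^sup>2
           + 2 * A_coeff q / (1 - q) * (\<Sum>j=1..n. p j * r j * (ln (p j / r j))\<^sup>2)
         \<le> jeffreys_tsallis_divergence n q p r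
       \<and> jeffreys_tsallis_divergence n q p r
         \<le> 4 * (1 - weight q) / (1 - q) * (hellinger_distance n p r)\<^sup>2
           + 2 * B_coeff q / (1 - q) * (\<Sum>j=1..n. p j * r j * (ln (p j / r j))\<^sup>2)"
proof -
  define J where "J j = p j + r j - p j powr q * r j powr (1 - q) - r j powr q * p j powr (1 - q)"
    for j
  define H where "H j = (sqrt (p j) - sqrt (r j))\<^sup>2" for j
  define L where "L j = p j * r j * (ln (p j / r j))\<^sup>2" for j
  have J: "jeffreys_tsallis_divergence n q p r = (\<Sum>j=1..n. J j) / (1 - q)"
    unfolding jeffreys_tsallis_divergence_def tsallis_divergence_def J_def
    by (simp add: sum_divide_distrib diff_divide_distrib add_divide_distrib flip: sum.distrib)
       (simp add: algebra_simps)
  have combine: "4 * c / (1 - q) * (hellinger_distance n p r)\<^sup>2 + 2 * d / (1 - q) * (\<Sum>j=1..n. L j)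
      = (\<Sum>j=1..n. 2 * c * H j + 2 * d * L j) / (1 - q)" for c d
    unfolding hellinger_distance_squared H_def[symmetric]
    using assms(6) by (simp add: sum.distrib divide_simps flip: sum_distrib_left)
      (simp add: algebra_simps)
  have bounds: "2 * weight q * H j + 2 * A_coeff q * L j \<le> J j"
    "J j \<le> 2 * (1 - weight q) * H j + 2 * B_coeff q * L j" if "j \<in> {1..n}" for j
    using jeffreys_pointwise_bounds[of "p j" "r j" q] that assms prob_distribution_le_1
    unfolding J_def H_def L_def by simp_all
  show ?thesis
    unfolding L_def[symmetric] J combine
    using assms bounds by (intro conjI divide_right_mono sum_mono) auto
qed

end
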